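(* For every positive integer $n$, $$\mu(n)=-2\sum_{i=0}^{\infty}(-1)^i(2\pi n)^{2i}\sum_{j=0}^{i}\frac{(-1)^j(2\pi)^{-2j}\zeta(2j)^{-1}}{(2i+1-2j)!}.$$
   Context: $\mu$ is the Möbius function: $\mu(1)=1$, $\mu(n)=(-1)^k$ if $n$ is square-free with $k$ prime factors, and $\mu(n)=0$ if $n$ is not square-free. $\zeta$ is the Riemann zeta function, with $\zeta(0)=-1/2$ (analytic continuation). The outer series over $i$ is summed in order of increasing $i$. *)

theory Defs
  imports
    "HOL-Complex_Analysis.Complex_Analysis"
    "HOL-Computational_Algebra.Computational_Algebra"
begin

definition moebius_mu :: "nat \<Rightarrow> int" where
  "moebius_mu n = (if squarefree n then (-1) ^ card (prime_factors n) else 0)"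

definition zeta_series :: "complex \<Rightarrow> complex" where
  "zeta_series s = (\<Sum>k. 1 / of_nat (Suc k) powr s)"

(* By the identity theorem the holomorphic f is unique on the connected set - {1}, so only
   the value at the pole 1 is left unspecified.  In particular riemann_zeta 0 is the value
   -1/2 of the analytic continuation. *)
definition riemann_zeta :: "complex \<Rightarrow> complex" where
  "riemann_zeta s =
     (if Re s > 1 then zeta_series s
      else (SOME f. f holomorphic_on (- {1}) \<and> (\<forall>w. Re w > 1 \<longrightarrow> f w = zeta_series w)) s)"

end

(* Let x = 2 pi n, so that sin x = 0.  The i-th term is the i-th coefficient of the Cauchy
   product of s(m) = (-1)^m x^(2m) / (2m+1)!, whose sum is sin x / x = 0, with the (divergent)
   series of n^(2j) / zeta(2j).  Since 1/zeta(2j) = sum_k mu(k) k^(-2j) for j >= 1, subtracting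
   the finitely many geometric parts mu(k) (n/k)^(2j), 1 <= k <= n, leaves an absolutely convergent
   series; by Mertens its product with s contributes 0, so the value of zeta at 0 is irrelevant.
   The product S of s with the geometric series of ratio q = (n/k)^2 satisfies
   S(i+1) = q (S(i) + s(i)).  Because sin(2 pi k) = 0, S(i) is q^i times minus a tail of the sine
   series, whence |S(i)| <= |s(i)| and S is summable.  Summing the recursion gives sum S = 0 if
   q is not 1; for k = n summation by parts gives sum S = - (sum of m s(m)) = - cos x / 2 = -1/2. *)

theory Submission
  imports Defs
begin

section \<open>Divisor sums of the Moebius function\<close>

lemma moebius_mu_prime_mult:
  assumes p: "prime p" and np: "\<not> p dvd d"
  shows "moebius_mu (p * d) = - moebius_mu d"
proof -
  have cop: "coprime p d" using p np by (rule prime_imp_coprime)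
  have d0: "d \<noteq> 0" using np by (intro notI) simp
  have sq: "squarefree (p * d) \<longleftrightarrow> squarefree d"
    using squarefree_mult_coprime[OF cop] squarefree_prime[OF p] squarefree_multD(2) by blast
  have "prime_factors (p * d) = insert p (prime_factors d)"
    using p d0 by (auto simp: prime_factors_product prime_prime_factors)
  moreover have "p \<notin> prime_factors d" using np by auto
  ultimately show ?thesis by (simp add: moebius_mu_def sq)
qed

text \<open>For a prime p dividing n, multiplication by p is a bijection from the squarefree
  divisors of n prime to p onto those divisible by p. It flips the sign of
  \<open>moebius_mu\<close>, so the two halves cancel.\<close>

lemma sum_moebius_mu_divisors:
  fixes n :: nat
  assumes "n > 0"
  shows "(\<Sum>d | d dvd n. moebius_mu d) = (if n = 1 then 1 else 0)"
proof (cases "n = 1")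
  case True
  then show ?thesis by (simp add: moebius_mu_def)
next
  case False
  then obtain p where p: "prime p" "p dvd n" using prime_factor_nat by blast
  let ?D = "{d. d dvd n \<and> squarefree d}"
  let ?A = "{d \<in> ?D. \<not> p dvd d}" and ?B = "{d \<in> ?D. p dvd d}"
  have fin: "finite {d. d dvd n}" using assms by simp
  have finD: "finite ?D" by (rule finite_subset[OF _ fin]) auto
  have inj: "inj_on ((*) p) ?A" using p by (auto simp: inj_on_def)
  have img: "?B = (*) p ` ?A"
  proof (intro equalityI subsetI)
    fix d assume d: "d \<in> ?B"
    then obtain e where e: "d = p * e" by auto
    have "\<not> p dvd e"
    proof
      assume "p dvd e"
      then have "p ^ 2 dvd d" using e by (simp add: power2_eq_square mult_dvd_mono)
      with d have "p dvd 1" using squarefreeD by blast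
      with p show False by simp
    qed
    with d e show "d \<in> (*) p ` ?A"
      by (auto dest: dvd_mult_right squarefree_multD(2))
  next
    fix d assume "d \<in> (*) p ` ?A"
    then obtain e where e: "d = p * e" "e dvd n" "squarefree e" "\<not> p dvd e" by auto
    have cop: "coprime p e" using p e by (intro prime_imp_coprime)
    with e p show "d \<in> ?B"
      using squarefree_mult_coprime[OF cop] squarefree_prime[OF p(1)] by (auto intro: divides_mult)
  qed
  have "(\<Sum>d | d dvd n. moebius_mu d) = (\<Sum>d\<in>?D. moebius_mu d)"
    by (rule sum.mono_neutral_right[OF fin]) (auto simp: moebius_mu_def)
  also have "\<dots> = sum moebius_mu ?A + sum moebius_mu ?B"
    by (subst sum.union_disjoint[symmetric]) (auto intro: finite_subset[OF _ finD] sum.cong)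
  also have "sum moebius_mu ?B = (\<Sum>d\<in>?A. moebius_mu (p * d))"
    unfolding img by (subst sum.reindex[OF inj]) simp
  also have "\<dots> = - sum moebius_mu ?A"
    using p by (simp add: moebius_mu_prime_mult sum_negf)
  finally show ?thesis using False by simp
qed

section \<open>Dirichlet series of 1 / \<zeta> at integers\<close>

lemma summable_on_inverse_power:
  assumes "m \<ge> 2"
  shows "(\<lambda>k::nat. 1 / real k ^ m) summable_on {0<..}"
proof -
  have "summable (\<lambda>k. 1 / real (Suc k) ^ m)"
    using inverse_power_summable[OF assms, where 'a = real]
    by (subst summable_Suc_iff) (simp add: divide_inverse)
  then have "(\<lambda>k. 1 / real (Suc k) ^ m) summable_on UNIV"
    by (intro norm_summable_imp_summable_on) simp
  moreover have "range Suc = {0<..}" by (auto simp: image_iff) (metis Suc_pred)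
  ultimately show ?thesis
    using summable_on_reindex[of Suc UNIV "\<lambda>k. 1 / real k ^ m"] by (simp add: o_def)
qed

lemma riemann_zeta_has_sum:
  assumes "m \<ge> 2"
  shows "((\<lambda>k. 1 / of_nat k ^ m) has_sum riemann_zeta (of_nat m)) {0<..}"
proof -
  let ?f = "\<lambda>k::nat. 1 / of_nat k ^ m :: complex"
  have summ: "?f summable_on {0<..}"
    by (rule Infinite_Sum.abs_summable_summable)
       (use summable_on_inverse_power[OF assms] in \<open>simp add: norm_divide norm_power\<close>)
  have img: "range Suc = {0<..}" by (auto simp: image_iff) (metis Suc_pred)
  have "((?f \<circ> Suc) has_sum infsum ?f {0<..}) UNIV"
    using has_sum_infsum[OF summ] has_sum_reindex[of Suc UNIV ?f] by (simp add: img)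
  then have "(?f \<circ> Suc) sums infsum ?f {0<..}" by (rule has_sum_imp_sums)
  moreover have "1 / of_nat (Suc k) powr of_nat m = (?f \<circ> Suc) k" for k
    by (subst powr_nat') (auto simp del: of_nat_Suc)
  ultimately have "zeta_series (of_nat m) = infsum ?f {0<..}"
    unfolding zeta_series_def by (simp only: sums_iff)
  with has_sum_infsum[OF summ] assms show ?thesis by (simp add: riemann_zeta_def)
qed

lemma norm_moebius_mu_le: "norm (of_int (moebius_mu k) :: complex) \<le> 1"
  by (simp add: moebius_mu_def)

text \<open>Dirichlet convolution: the product of the series for \<mu> and \<zeta> is a sum over
  pairs (d, e); grouping the pairs by n = d * e leaves the divisor sum of \<mu>, which vanishes
  except at n = 1.\<close>

lemma moebius_mu_has_sum:
  assumes m: "m \<ge> 2"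
  shows "((\<lambda>k. of_int (moebius_mu k) / of_nat k ^ m) has_sum
            inverse (riemann_zeta (of_nat m))) {0<..}"
proof -
  let ?f = "\<lambda>k. of_int (moebius_mu k) / of_nat k ^ m :: complex"
  let ?g = "\<lambda>k::nat. 1 / of_nat k ^ m :: complex"
  let ?A = "{0::nat<..}"
  let ?D = "\<lambda>n::nat. {d. d dvd n}"
  have absg: "(\<lambda>k. norm (?g k)) summable_on ?A"
    using summable_on_inverse_power[OF m] by (simp add: norm_divide norm_power)
  have absf: "(\<lambda>k. norm (?f k)) summable_on ?A"
    by (rule Infinite_Sum.abs_summable_on_comparison_test[OF absg])
       (simp add: norm_divide norm_power divide_right_mono norm_moebius_mu_le[simplified])
  define F where "F = infsum ?f ?A"
  let ?Z = "riemann_zeta (of_nat m)"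
  have F: "(?f has_sum F) ?A"
    unfolding F_def by (rule has_sum_infsum[OF Infinite_Sum.abs_summable_summable[OF absf]])
  \<comment> \<open>Absolute summability over pairs identifies the double sum with the product
    \<open>F * ?Z\<close>; the sum is then regrouped by the value of d * e.\<close>
  have summ: "(\<lambda>(d, e). ?f d * ?g e) summable_on ?A \<times> ?A"
  proof (rule Infinite_Sum.abs_summable_summable, subst Infinite_Sum.abs_summable_on_Sigma_iff,
         intro conjI ballI)
    show "(\<lambda>e. norm (case (d, e) of (d, e) \<Rightarrow> ?f d * ?g e)) summable_on ?A" for d
      unfolding norm_mult prod.case by (intro summable_on_cmult_right absg)
    show "(\<lambda>d. norm (\<Sum>\<^sub>\<infinity>e\<in>?A. norm (case (d, e) of (d, e) \<Rightarrow> ?f d * ?g e))) summable_on ?A"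
      unfolding norm_mult prod.case infsum_cmult_right'
      by (simp only: real_norm_def abs_mult abs_norm_cancel) (intro summable_on_cmult_left absf)
  qed
  have "((\<lambda>(d, e). ?f d * ?g e) has_sum F * ?Z) (?A \<times> ?A)"
    by (rule has_sum_SigmaI[OF _ has_sum_cmult_left[OF F] summ])
       (unfold prod.case, intro has_sum_cmult_right riemann_zeta_has_sum m)
  also have "?this \<longleftrightarrow> ((\<lambda>(n, d). ?f d * ?g (n div d)) has_sum F * ?Z) (Sigma ?A ?D)"
    by (rule has_sum_reindex_bij_witness[where j = "\<lambda>(d, e). (d * e, d)" and i = "\<lambda>(n, d). (d, n div d)"])
       (auto elim!: dvdE)
  finally have "((\<lambda>(n, d). ?f d * ?g (n div d)) has_sum F * ?Z) (Sigma ?A ?D)" .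
  then have "((\<lambda>n. \<Sum>d | d dvd n. ?f d * ?g (n div d)) has_sum F * ?Z) ?A"
    by (rule has_sum_SigmaD) (auto intro!: has_sum_finiteI)
  moreover have "(\<Sum>d | d dvd n. ?f d * ?g (n div d)) = (if n = 1 then 1 else 0)" if "n \<in> ?A" for n
  proof -
    have "(\<Sum>d | d dvd n. ?f d * ?g (n div d))
        = (\<Sum>d | d dvd n. of_int (moebius_mu d) / of_nat n ^ m)"
      by (intro sum.cong refl) (auto simp flip: power_mult_distrib of_nat_mult)
    also have "\<dots> = of_int (\<Sum>d | d dvd n. moebius_mu d) / of_nat n ^ m"
      by (simp add: sum_divide_distrib)
    also have "(\<Sum>d | d dvd n. moebius_mu d) = (if n = 1 then 1 else 0)"
      using that by (intro sum_moebius_mu_divisors) simp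
    finally show ?thesis by simp
  qed
  ultimately have "((\<lambda>n. if n = 1 then 1 else 0) has_sum F * ?Z) ?A"
    by (rule has_sum_cong[THEN iffD1, rotated])
  moreover have "((\<lambda>n::nat. if n = 1 then 1 else 0 :: complex) has_sum 1) ?A"
    by (rule has_sum_finite_neutralI[of "{1}"]) auto
  ultimately have "F * ?Z = 1" by (rule has_sum_unique)
  \<comment> \<open>The equation \<open>F * ?Z = 1\<close> also shows that \<zeta> does not vanish
    here, so \<open>inverse\<close> does not take its default value 0.\<close>
  then have "F = inverse ?Z" by (metis inverse_unique mult.commute)
  with F show ?thesis by simp
qed

text \<open>Every remaining k exceeds n, so n/k \<le> n/(n+1) < 1. Of the m factors n/k, two are
  kept to make the sum over k converge; the other m - 2 give geometric decay in m.\<close>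

lemma norm_moebius_mu_tail_le:
  assumes n: "n > 0" and m: "m \<ge> 2"
  shows "norm (of_nat n ^ m * inverse (riemann_zeta (of_nat m))
            - (\<Sum>k=1..n. of_int (moebius_mu k) * (of_nat n / of_nat k) ^ m))
         \<le> (real n / real (Suc n)) ^ (m - 2) * ((real n)\<^sup>2 * (\<Sum>\<^sub>\<infinity>k\<in>{n<..}. 1 / (real k)\<^sup>2))"
proof (rule norm_infsum_le)
  let ?f = "\<lambda>k. of_nat n ^ m * (of_int (moebius_mu k) / of_nat k ^ m) :: complex"
  have "(?f has_sum (of_nat n ^ m * inverse (riemann_zeta (of_nat m)) - sum ?f {1..n})) ({0<..} - {1..n})"
    by (intro has_sum_Diff has_sum_cmult_right moebius_mu_has_sum m has_sum_finite) auto
  also have "{0<..} - {1..n} = {n<..}" by auto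
  also have "sum ?f {1..n} = (\<Sum>k=1..n. of_int (moebius_mu k) * (of_nat n / of_nat k) ^ m)"
    by (simp add: power_divide mult.commute)
  finally show "(?f has_sum (of_nat n ^ m * inverse (riemann_zeta (of_nat m))
            - (\<Sum>k=1..n. of_int (moebius_mu k) * (of_nat n / of_nat k) ^ m))) {n<..}" .
next
  have "(\<lambda>k. 1 / (real k)\<^sup>2) summable_on {n<..}"
    by (rule summable_on_subset[OF summable_on_inverse_power]) auto
  then show "((\<lambda>k. (real n / real (Suc n)) ^ (m - 2) * ((real n)\<^sup>2 * (1 / (real k)\<^sup>2))) has_sum
      (real n / real (Suc n)) ^ (m - 2) * ((real n)\<^sup>2 * (\<Sum>\<^sub>\<infinity>k\<in>{n<..}. 1 / (real k)\<^sup>2))) {n<..}"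
    by (intro has_sum_cmult_right has_sum_infsum)
next
  fix k assume "k \<in> {n<..}"
  then have k: "n < k" by simp
  have "norm (of_nat n ^ m * (of_int (moebius_mu k) / of_nat k ^ m) :: complex)
      = norm (of_int (moebius_mu k) :: complex) * (real n / real k) ^ m"
    by (simp add: norm_mult norm_divide norm_power power_divide)
  also have "\<dots> \<le> 1 * (real n / real k) ^ m"
    by (intro mult_right_mono norm_moebius_mu_le) simp
  also have "\<dots> = (real n / real k) ^ (m - 2) * (real n / real k)\<^sup>2"
    using m by (simp only: le_add_diff_inverse2 flip: power_add)
  also have "\<dots> \<le> (real n / real (Suc n)) ^ (m - 2) * (real n / real k)\<^sup>2"
    using k by (intro mult_right_mono power_mono divide_left_mono) auto
  also have "(real n / real k)\<^sup>2 = (real n)\<^sup>2 * (1 / (real k)\<^sup>2)"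
    by (simp add: power_divide)
  finally show "norm (of_nat n ^ m * (of_int (moebius_mu k) / of_nat k ^ m) :: complex)
      \<le> (real n / real (Suc n)) ^ (m - 2) * ((real n)\<^sup>2 * (1 / (real k)\<^sup>2))" .
qed

section \<open>Power series of sin x / x\<close>

definition sinc_term :: "real \<Rightarrow> nat \<Rightarrow> real" where
  "sinc_term x m = (-1) ^ m * x ^ (2 * m) / fact (2 * m + 1)"

lemma sinc_term_sums:
  assumes "x \<noteq> 0"
  shows "sinc_term x sums (sin x / x)"
  using sums_divide[OF sin_paired[of x], of x] assms by (simp add: sinc_term_def cong: sums_cong)

text \<open>Multiplying \<open>sinc_term x m\<close> by 2m + 1 gives the m-th cosine term, so
  \<open>real m * sinc_term x m\<close> is half the difference of the two terms; the sinc series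
  sums to 0.\<close>

lemma sinc_term_weighted_sums:
  assumes "x \<noteq> 0" "sin x = 0"
  shows "(\<lambda>m. real m * sinc_term x m) sums (cos x / 2)"
proof -
  have "sinc_term x sums 0"
    using sinc_term_sums[of x] assms by simp
  then have "(\<lambda>m. ((-1) ^ m / fact (2 * m) * x ^ (2 * m) - sinc_term x m) / 2) sums ((cos x - 0) / 2)"
    by (intro sums_divide sums_diff cos_paired)
  moreover have "((-1) ^ m / fact (2 * m) * x ^ (2 * m) - sinc_term x m) / 2 = real m * sinc_term x m" for m
    by (simp add: sinc_term_def divide_simps) (simp add: algebra_simps)
  ultimately show ?thesis by simp
qed

lemma summable_abs_sinc_term: "summable (\<lambda>m. \<bar>sinc_term x m\<bar>)"
proof (rule summable_comparison_test')
  show "summable (\<lambda>m. inverse (fact m) * (x\<^sup>2) ^ m)" by (rule summable_exp)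
  show "norm \<bar>sinc_term x m\<bar> \<le> inverse (fact m) * (x\<^sup>2) ^ m" if "m \<ge> 0" for m
  proof -
    have "(fact m :: real) \<le> fact (2 * m + 1)" by (rule fact_mono) simp
    then have "x ^ (2 * m) / fact (2 * m + 1) \<le> x ^ (2 * m) / fact m"
      by (intro divide_left_mono) (auto simp: power_mult)
    moreover have "\<bar>sinc_term x m\<bar> = x ^ (2 * m) / fact (2 * m + 1)"
      by (simp add: sinc_term_def abs_mult del: fact_Suc)
    ultimately show ?thesis by (simp add: divide_inverse mult.commute del: fact_Suc flip: power_mult)
  qed
qed

text \<open>This is the Maclaurin remainder bound for sine, divided by |x|. It needs no monotonicity
  of the terms, so it holds for every i, however large x is.\<close>

lemma sinc_partial_sum_bound:
  assumes "x \<noteq> 0"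
  shows "\<bar>sin x / x - (\<Sum>m<i. sinc_term x m)\<bar> \<le> \<bar>sinc_term x i\<bar>"
proof -
  \<comment> \<open>The even coefficient at 2i is zero; including it raises the order of the
    remainder to 2i + 1, which matches \<open>sinc_term x i\<close>.\<close>
  have eq: "(\<Sum>m<2 * i + 1. sin_coeff m * x ^ m) = x * (\<Sum>m<i. sinc_term x m)"
    by (induction i) (auto simp: sin_coeff_def sinc_term_def algebra_simps simp del: fact_Suc)
  have "\<bar>x\<bar> * \<bar>sin x / x - (\<Sum>m<i. sinc_term x m)\<bar> = \<bar>sin x - x * (\<Sum>m<i. sinc_term x m)\<bar>"
    using assms by (simp add: right_diff_distrib flip: abs_mult)
  also have "\<dots> \<le> inverse (fact (2 * i + 1)) * \<bar>x\<bar> ^ (2 * i + 1)"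
    using Maclaurin_sin_bound[of x "2 * i + 1"] unfolding eq .
  also have "\<dots> = \<bar>x\<bar> * \<bar>sinc_term x i\<bar>"
    by (simp add: sinc_term_def abs_mult power_abs divide_inverse mult_ac del: fact_Suc)
  finally show ?thesis using assms by simp
qed

section \<open>Cauchy product of the sinc series with a geometric series\<close>

text \<open>The geometric series starts at j = 1, because the Dirichlet series of \<mu> gives 1 /
  \<zeta>(2j) only for j \<ge> 1.\<close>

definition sinc_conv :: "real \<Rightarrow> real \<Rightarrow> nat \<Rightarrow> real" where
  "sinc_conv x q i = (\<Sum>j=1..i. q ^ j * sinc_term x (i - j))"

lemma sinc_conv_0 [simp]: "sinc_conv x q 0 = 0"
  by (simp add: sinc_conv_def)

lemma sinc_conv_Suc: "sinc_conv x q (Suc i) = q * (sinc_conv x q i + sinc_term x i)"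
proof -
  have "sinc_conv x q (Suc i) = (\<Sum>j=0..i. q ^ Suc j * sinc_term x (i - j))"
    unfolding sinc_conv_def One_nat_def by (subst sum.atLeast_Suc_atMost_Suc_shift) simp
  also have "\<dots> = q * sinc_term x i + (\<Sum>j=1..i. q ^ Suc j * sinc_term x (i - j))"
    by (subst sum.atLeast_Suc_atMost) auto
  finally show ?thesis
    by (simp add: sinc_conv_def sum_distrib_left algebra_simps)
qed

text \<open>With q = (x/y)^2 one has \<open>sinc_term x m = q ^ m * sinc_term y m\<close>, so every
  summand of the convolution carries the same factor q^i.\<close>

lemma sinc_conv_eq_partial_sum:
  assumes "y \<noteq> 0"
  shows "sinc_conv x ((x / y)\<^sup>2) i = ((x / y)\<^sup>2) ^ i * (\<Sum>m<i. sinc_term y m)"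
proof (induction i)
  case (Suc i)
  have "sinc_term x i = ((x / y)\<^sup>2) ^ i * sinc_term y i"
    using assms by (simp add: sinc_term_def power_divide power_mult)
  with Suc show ?case by (simp add: sinc_conv_Suc algebra_simps)
qed simp

text \<open>The full series at y sums to 0, so a partial sum is minus its tail and is bounded by the
  first omitted term; the factor q^i turns that term back into \<open>sinc_term x i\<close>.\<close>

lemma sinc_conv_bound:
  assumes "y \<noteq> 0" "sin y = 0"
  shows "\<bar>sinc_conv x ((x / y)\<^sup>2) i\<bar> \<le> \<bar>sinc_term x i\<bar>"
proof -
  have "\<bar>sinc_conv x ((x / y)\<^sup>2) i\<bar> = ((x / y)\<^sup>2) ^ i * \<bar>\<Sum>m<i. sinc_term y m\<bar>"
    by (simp add: sinc_conv_eq_partial_sum[OF assms(1)] abs_mult)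
  also have "\<dots> \<le> ((x / y)\<^sup>2) ^ i * \<bar>sinc_term y i\<bar>"
    using sinc_partial_sum_bound[of y i] assms by (intro mult_left_mono) auto
  also have "\<dots> = \<bar>sinc_term x i\<bar>"
    using assms by (simp add: sinc_term_def abs_mult power_divide power_mult)
  finally show ?thesis .
qed

lemma sinc_conv_sums:
  assumes x: "x \<noteq> 0" "sin x = 0" and y: "y \<noteq> 0" "sin y = 0"
  shows "sinc_conv x ((x / y)\<^sup>2) sums (if (x / y)\<^sup>2 = 1 then - cos x / 2 else 0)"
proof (cases "(x / y)\<^sup>2 = 1")
  case False
  let ?S = "sinc_conv x ((x / y)\<^sup>2)"
  have s: "sinc_term x sums 0"
    using sinc_term_sums[of x] x by simp
  have "summable ?S"
    by (rule summable_comparison_test'[OF summable_abs_sinc_term[of x]])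
       (use sinc_conv_bound[OF y] in simp)
  then have S: "?S sums suminf ?S" by (rule summable_sums)
  \<comment> \<open>The shifted series has the same sum because \<open>sinc_conv\<close> vanishes at
    0, so the sum is a fixed point of multiplication by q.\<close>
  have "(\<lambda>i. ?S (Suc i)) sums ((x / y)\<^sup>2 * (suminf ?S + 0))"
    unfolding sinc_conv_Suc by (intro sums_mult sums_add S s)
  then have "?S sums ((x / y)\<^sup>2 * suminf ?S)"
    by (subst (asm) sums_Suc_iff) simp
  with S have "suminf ?S = (x / y)\<^sup>2 * suminf ?S" by (rule sums_unique2)
  with False have "suminf ?S = 0" by simp
  with S False show ?thesis by simp
next
  case True
  have s: "sinc_term x sums 0"
    using sinc_term_sums[of x] x by simp
  have ms: "(\<lambda>m. real m * sinc_term x m) sums (cos x / 2)"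
    by (rule sinc_term_weighted_sums[OF x])
  \<comment> \<open>Summation by parts: for q = 1 the increments of \<open>sinc_conv x 1\<close> are
    the sinc terms.\<close>
  have parts: "(\<Sum>i<N. sinc_conv x 1 i)
      = real N * sinc_conv x 1 N - (\<Sum>m<N. real m * sinc_term x m + sinc_term x m)" for N
    by (induction N) (auto simp: sinc_conv_Suc algebra_simps)
  have "(\<lambda>N. real N * sinc_term x N) \<longlonglongrightarrow> 0"
    using ms by (intro summable_LIMSEQ_zero) (rule sums_summable)
  \<comment> \<open>The boundary term is dominated by N |s(N)|, where N s(N) is the general term of
    a convergent series.\<close>
  then have "(\<lambda>N. real N * sinc_conv x 1 N) \<longlonglongrightarrow> 0"
    by (rule Lim_null_comparison[rotated, OF tendsto_rabs_zero])
       (use sinc_conv_bound[OF y, of x] True in \<open>auto simp: abs_mult intro!: always_eventually mult_left_mono\<close>)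
  moreover have "(\<lambda>N. \<Sum>m<N. real m * sinc_term x m + sinc_term x m) \<longlonglongrightarrow> cos x / 2 + 0"
    using sums_add[OF ms s] by (simp add: sums_def)
  ultimately have "sinc_conv x 1 sums (0 - (cos x / 2 + 0))"
    unfolding sums_def parts by (rule tendsto_diff)
  with True show ?thesis by simp
qed

section \<open>Splitting the double series and evaluating its parts\<close>

theorem mainTheorem3:
  fixes n :: nat and t :: "nat \<Rightarrow> complex"
  assumes "n > 0"
  defines "t \<equiv> \<lambda>i. (-1) ^ i * (2 * of_real pi * of_nat n) ^ (2 * i) *
             (\<Sum>j = 0..i. (-1) ^ j * (2 * of_real pi) powi (- (2 * int j)) *
                inverse (riemann_zeta (of_nat (2 * j))) / fact (2 * i + 1 - 2 * j))"
  shows "summable t \<and> of_int (moebius_mu n) = - 2 * (\<Sum>i. t i)"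
proof -
  define x where "x = 2 * pi * real n"
  have sin0: "sin (2 * pi * real k) = 0" for k
    using sin_npi2[of "2 * k"] by (simp add: mult_ac)
  have cos1: "cos x = 1"
    using cos_npi2[of "2 * n"] by (simp add: x_def mult_ac)
  have x: "x \<noteq> 0" "sin x = 0" using assms(1) sin0[of n] by (auto simp: x_def)
  define w where "w j = of_nat n ^ (2 * j) * inverse (riemann_zeta (of_nat (2 * j)))" for j
  \<comment> \<open>The index j = 0 stays in \<open>b\<close>: the Dirichlet series of the Moebius function does not represent
    \<open>1 / \<zeta>(0)\<close>.\<close>
  define v where "v j = (if j = 0 then 0 else
      \<Sum>k=1..n. of_int (moebius_mu k) * (of_nat n / of_nat k) ^ (2 * j) :: complex)" for j
  define b where "b j = w j - v j" for j

  \<comment> \<open>The negative powers of 2 \<pi> cancel against (2 \<pi> n)^(2i), leaving n^(2j)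
    (2 \<pi> n)^(2(i-j)), and the signs combine to (-1)^(i-j).\<close>
  have t_eq: "t i = (\<Sum>j\<le>i. w j * of_real (sinc_term x (i - j)))" for i
    unfolding t_def sum_distrib_left atLeast0AtMost
  proof (intro sum.cong refl)
    fix j assume "j \<in> {..i}"
    \<comment> \<open>Writing i = j + m removes the truncated subtraction in the factorial.\<close>
    then obtain m where i: "i = j + m" by (auto simp: le_iff_add)
    define P where "P = (2 * of_real pi :: complex)"
    have P: "P powi (- (2 * int j)) = inverse (P ^ (2 * j))"
      using power_int_of_nat[of P "2 * j"] by (simp add: power_int_minus)
    have sign: "(-1) ^ (j + m) * (-1) ^ j = ((-1) ^ m :: complex)"
      by (simp add: power_add mult_ac flip: power_mult_distrib)
    have pow: "(P * of_nat n) ^ (2 * (j + m)) * inverse (P ^ (2 * j)) = of_nat n ^ (2 * j) * (P * of_nat n) ^ (2 * m)"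
      by (simp add: P_def power_mult_distrib power_add distrib_left field_simps)
    have s: "of_real (sinc_term x m) = (-1) ^ m * (P * of_nat n) ^ (2 * m) / fact (2 * m + 1)"
      by (simp add: sinc_term_def x_def P_def del: fact_Suc)
    have "(-1) ^ (j + m) * (P * of_nat n) ^ (2 * (j + m)) *
        ((-1) ^ j * inverse (P ^ (2 * j)) * inverse (riemann_zeta (of_nat (2 * j))) / fact (2 * m + 1))
      = ((-1) ^ (j + m) * (-1) ^ j) * ((P * of_nat n) ^ (2 * (j + m)) * inverse (P ^ (2 * j))) *
        inverse (riemann_zeta (of_nat (2 * j))) / fact (2 * m + 1)"
      by (simp only: divide_inverse mult_ac)
    also have "\<dots> = w j * of_real (sinc_term x m)"
      unfolding sign pow s w_def by (simp only: divide_inverse mult_ac)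
    finally show "(-1) ^ i * (2 * of_real pi * of_nat n) ^ (2 * i) *
        ((-1) ^ j * (2 * of_real pi) powi (- (2 * int j)) *
          inverse (riemann_zeta (of_nat (2 * j))) / fact (2 * i + 1 - 2 * j))
      = w j * of_real (sinc_term x (i - j))"
      unfolding P_def[symmetric] P i by simp
  qed
  \<comment> \<open>The ratio for k is (n/k)^2, written as (x/y)^2 with y = 2 \<pi> k, a zero of
    sine.\<close>
  have conv_v: "(\<Sum>j\<le>i. v j * of_real (sinc_term x (i - j)))
      = (\<Sum>k=1..n. of_int (moebius_mu k) * of_real (sinc_conv x ((x / (2 * pi * real k))\<^sup>2) i))" for i
  proof -
    have "(\<Sum>j\<le>i. v j * of_real (sinc_term x (i - j)))
        = (\<Sum>j=1..i. \<Sum>k=1..n. of_int (moebius_mu k) * ((of_nat n / of_nat k) ^ (2 * j)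
             * of_real (sinc_term x (i - j))))"
      unfolding atLeast0AtMost[symmetric]
      by (subst sum.atLeast_Suc_atMost) (auto simp: v_def sum_distrib_right mult.assoc intro!: sum.cong)
    also have "\<dots> = (\<Sum>k=1..n. of_int (moebius_mu k) * (\<Sum>j=1..i. (of_nat n / of_nat k) ^ (2 * j)
             * of_real (sinc_term x (i - j))))"
      by (subst sum.swap) (simp add: sum_distrib_left)
    also have "\<dots> = (\<Sum>k=1..n. of_int (moebius_mu k) * of_real (sinc_conv x ((x / (2 * pi * real k))\<^sup>2) i))"
      by (simp add: sinc_conv_def x_def power_mult)
    finally show ?thesis .
  qed

  \<comment> \<open>The tail bound at exponent 2(j + 1) leaves (n/(n+1))^(2j). The term
    \<open>b 0\<close> escapes the bound but cannot affect summability.\<close>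
  have "norm (b (Suc j)) \<le> ((real n / real (Suc n))\<^sup>2) ^ j * ((real n)\<^sup>2 * (\<Sum>\<^sub>\<infinity>k\<in>{n<..}. 1 / (real k)\<^sup>2))" for j
    using norm_moebius_mu_tail_le[OF assms(1), of "2 * Suc j"]
    by (simp add: b_def v_def w_def power_mult)
  moreover have "summable (\<lambda>j. ((real n / real (Suc n))\<^sup>2) ^ j * ((real n)\<^sup>2 * (\<Sum>\<^sub>\<infinity>k\<in>{n<..}. 1 / (real k)\<^sup>2)))"
    by (intro summable_mult2 summable_geometric) (simp add: power_less_one_iff abs_square_less_1)
  ultimately have "summable (\<lambda>j. norm (b (Suc j)))"
    by (intro summable_comparison_test'[of _ 0 "\<lambda>j. norm (b (Suc j))"]) auto
  then have b_summable: "summable (\<lambda>j. norm (b j))" by (subst (asm) summable_Suc_iff)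
  have "(\<lambda>j. of_real (sinc_term x j) :: complex) sums of_real (sin x / x)"
    by (intro sums_of_real sinc_term_sums x)
  then have "(\<Sum>j. of_real (sinc_term x j) :: complex) = 0" using x by (simp add: sums_iff)
  \<comment> \<open>Both factors converge absolutely and the sinc factor is 0, so the product is 0
    whatever the sum of \<open>b\<close> is.\<close>
  moreover have "(\<lambda>i. \<Sum>j\<le>i. b j * of_real (sinc_term x (i - j)))
      sums ((\<Sum>j. b j) * (\<Sum>j. of_real (sinc_term x j)))"
    by (rule Cauchy_product_sums[OF b_summable]) (simp add: summable_abs_sinc_term)
  ultimately have conv_b: "(\<lambda>i. \<Sum>j\<le>i. b j * of_real (sinc_term x (i - j))) sums 0" by simp
  have "(\<lambda>i. (\<Sum>j\<le>i. b j * of_real (sinc_term x (i - j))) + (\<Sum>j\<le>i. v j * of_real (sinc_term x (i - j))))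
      sums (0 + (\<Sum>k=1..n. of_int (moebius_mu k) *
        of_real (if (x / (2 * pi * real k))\<^sup>2 = 1 then - cos x / 2 else 0)))"
    unfolding conv_v
    by (intro sums_add conv_b sums_sum sums_mult sums_of_real sinc_conv_sums x) (auto simp: sin0)
  moreover have "(\<Sum>j\<le>i. b j * of_real (sinc_term x (i - j))) + (\<Sum>j\<le>i. v j * of_real (sinc_term x (i - j))) = t i" for i
    unfolding t_eq sum.distrib[symmetric] by (simp add: b_def algebra_simps)
  \<comment> \<open>Only k = n has ratio 1, since k and n are positive; this selects the single
    value \<mu>(n).\<close>
  moreover have "(x / (2 * pi * real k))\<^sup>2 = 1 \<longleftrightarrow> k = n" if "k \<in> {1..n}" for k
    using that by (auto simp: x_def power2_eq_1_iff field_simps)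
  then have "(\<Sum>k=1..n. of_int (moebius_mu k) *
        of_real (if (x / (2 * pi * real k))\<^sup>2 = 1 then - cos x / 2 else 0))
      = (\<Sum>k=1..n. if k = n then - of_int (moebius_mu n) / 2 else (0 :: complex))"
    by (intro sum.cong) (auto simp: cos1)
  ultimately have "t sums (- of_int (moebius_mu n) / 2)"
    using assms(1) by simp
  then show ?thesis by (simp add: sums_iff)
qed
end
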